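(* Let $d\ge1$ and $t\ge1$ be integers and let $Z\subset\mathfrak{S}_d$ be a subgroup that is $(t-1)$-transitive and $t$-homogeneous. Then for every $x\in\mathbb{R}^d$ and every $f\in\mathbb{R}_t[y_1,\ldots,y_d]$, \[ \frac{1}{|\mathfrak{S}_d\cdot x|}\sum_{y\in\mathfrak{S}_d\cdot x}f(y)=\frac{1}{|Z\cdot x|}\sum_{y\in Z\cdot x}f(y). \]
   Context: $\mathfrak{S}_d$ is the symmetric group on $[d]=\{1,\ldots,d\}$. For $x=(x_1,\ldots,x_d)\in\mathbb{R}^d$ and a subgroup $Z\le\mathfrak{S}_d$, $Z\cdot x=\{(x_{\sigma(1)},\ldots,x_{\sigma(d)})\mid\sigma\in Z\}$ (a set). A subgroup $H\le\mathfrak{S}_d$ is $k$-homogeneous if it acts transitively on the set of $k$-element subsets of $[d]$, and $k$-transitive if it acts transitively on the set of ordered $k$-tuples of distinct elements of $[d]$ (every subgroup is $0$-transitive). $\mathbb{R}_t[y_1,\ldots,y_d]$ is the space of real polynomials of total degree at most $t$. *)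

theory Defs
  imports
    Complex_Main
    "HOL-Library.FuncSet"
    "HOL-Library.Poly_Mapping"
    "HOL-Algebra.Sym_Groups"
    "HOL-Algebra.Group_Action"
begin

text \<open>
  The space of real vectors of length \<open>d\<close> is \<open>{1..d} \<rightarrow>\<^sub>E UNIV\<close>: outside \<open>{1..d}\<close> a vector takes the
  fixed value \<open>undefined\<close>, so that equality of functions is equality of vectors.  This set is closed
  under composition with elements of \<open>sym_group d\<close>.
\<close>

definition perm_orbit :: "(nat \<Rightarrow> nat) set \<Rightarrow> (nat \<Rightarrow> real) \<Rightarrow> (nat \<Rightarrow> real) set" where
  "perm_orbit Z x = {(\<lambda>i. x (\<sigma> i)) | \<sigma>. \<sigma> \<in> Z}"

text \<open>
  An action is transitive if it has exactly one orbit; in particular the set acted on is nonempty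
  (this differs from the locale \<open>transitive_action\<close>, which admits the empty set).  Hence
  \<open>k\<close>-transitivity and \<open>k\<close>-homogeneity include \<open>k \<le> d\<close>.
\<close>

definition acts_transitively_on :: "nat \<Rightarrow> (nat \<Rightarrow> nat) set \<Rightarrow> ((nat \<Rightarrow> nat) \<Rightarrow> 'b \<Rightarrow> 'b) \<Rightarrow> 'b set \<Rightarrow> bool" where
  "acts_transitively_on d H \<phi> E \<longleftrightarrow> orbits ((sym_group d)\<lparr>carrier := H\<rparr>) E \<phi> = {E}"

definition homogeneous :: "nat \<Rightarrow> nat \<Rightarrow> (nat \<Rightarrow> nat) set \<Rightarrow> bool" where
  "homogeneous d k H \<longleftrightarrow>
     acts_transitively_on d H (\<lambda>\<sigma> A. \<sigma> ` A) {A. A \<subseteq> {1..d} \<and> card A = k}"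

definition multiply_transitive :: "nat \<Rightarrow> nat \<Rightarrow> (nat \<Rightarrow> nat) set \<Rightarrow> bool" where
  "multiply_transitive d k H \<longleftrightarrow>
     acts_transitively_on d H map {xs. length xs = k \<and> distinct xs \<and> set xs \<subseteq> {1..d}}"

text \<open>
  A polynomial maps each monomial to its coefficient, and a monomial maps each variable index to
  its exponent.
\<close>

type_synonym real_mpoly = "(nat \<Rightarrow>\<^sub>0 nat) \<Rightarrow>\<^sub>0 real"

definition monomial_degree :: "(nat \<Rightarrow>\<^sub>0 nat) \<Rightarrow> nat" where
  "monomial_degree m = (\<Sum>i\<in>Poly_Mapping.keys m. Poly_Mapping.lookup m i)"

definition mpolys_le :: "nat \<Rightarrow> nat \<Rightarrow> real_mpoly set" where
  "mpolys_le d t =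
     {f. \<forall>m\<in>Poly_Mapping.keys f. Poly_Mapping.keys m \<subseteq> {1..d} \<and> monomial_degree m \<le> t}"

definition mpoly_eval :: "real_mpoly \<Rightarrow> (nat \<Rightarrow> real) \<Rightarrow> real" where
  "mpoly_eval f y =
     (\<Sum>m\<in>Poly_Mapping.keys f. Poly_Mapping.lookup f m *
        (\<Prod>i\<in>Poly_Mapping.keys m. y i ^ Poly_Mapping.lookup m i))"

end

theory Submission
  imports Defs
begin

text \<open>
  The map \<open>\<sigma> \<mapsto> x \<circ> \<sigma>\<close> on a finite group has fibres of equal size, so a mean over an orbit is a mean
  over the group, and by linearity it suffices to treat a monomial \<open>M\<close> of degree at most \<open>t\<close>. For
  every permutation \<open>\<tau>\<close> there is \<open>\<rho> \<in> Z\<close> with \<open>M (y \<circ> \<tau>) = M (y \<circ> \<rho>)\<close> for all \<open>y\<close>: if \<open>M\<close> involves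
  fewer than \<open>t\<close> variables, \<open>\<rho>\<close> can be chosen to agree with \<open>\<tau>\<close> on them; otherwise \<open>M\<close> is a product
  of \<open>t\<close> distinct variables and \<open>\<rho>\<close> need only map this set of variables to the same image. Hence the
  mean of \<open>M (x \<circ> \<sigma> \<circ> \<tau>)\<close> over \<open>\<sigma> \<in> Z\<close> does not depend on \<open>\<tau>\<close>, and averaging over \<open>\<tau>\<close> gives the
  claim.
\<close>

definition mean :: "('a \<Rightarrow> 'b::field_char_0) \<Rightarrow> 'a set \<Rightarrow> 'b" where
  "mean F A = (\<Sum>a\<in>A. F a) / of_nat (card A)"

lemma mean_cong: "(\<And>a. a \<in> A \<Longrightarrow> F a = G a) \<Longrightarrow> mean F A = mean G A"
  by (simp add: mean_def cong: sum.cong)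

lemma mean_const: "finite A \<Longrightarrow> A \<noteq> {} \<Longrightarrow> mean (\<lambda>_. c) A = c"
  by (simp add: mean_def)

lemma mean_reindex_bij_betw: "bij_betw h A B \<Longrightarrow> mean (\<lambda>a. F (h a)) A = mean F B"
  by (simp add: mean_def bij_betw_same_card sum.reindex_bij_betw)

lemma mean_swap: "mean (\<lambda>a. mean (\<lambda>b. F a b) B) A = mean (\<lambda>b. mean (\<lambda>a. F a b) A) B"
  unfolding mean_def sum_divide_distrib[symmetric] by (subst sum.swap) (simp add: mult.commute)

lemma mean_linear_combination:
  "mean (\<lambda>a. \<Sum>i\<in>I. c i * F i a) A = (\<Sum>i\<in>I. c i * mean (F i) A)"
  unfolding mean_def by (subst sum.swap) (simp add: sum_distrib_left sum_divide_distrib)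

lemma mean_image_equal_card_fibres:
  assumes "finite A" and fibre: "\<And>y. y \<in> f ` A \<Longrightarrow> card {a \<in> A. f a = y} = c"
  shows "mean F (f ` A) = mean (\<lambda>a. F (f a)) A"
proof (cases "A = {}")
  case False
  have sum_eq: "(\<Sum>a\<in>A. G (f a)) = of_nat c * (\<Sum>y\<in>f ` A. G y)" for G :: "'b \<Rightarrow> 'c"
  proof -
    have "(\<Sum>a\<in>A. G (f a)) = (\<Sum>y\<in>f ` A. \<Sum>a\<in>{a \<in> A. f a = y}. G (f a))"
      by (rule sum.image_gen[OF \<open>finite A\<close>])
    also have "\<dots> = (\<Sum>y\<in>f ` A. of_nat c * G y)"
      by (rule sum.cong) (simp_all add: fibre)
    finally show ?thesis by (simp add: sum_distrib_left)
  qed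
  have card_eq: "of_nat (card A) = (of_nat c * of_nat (card (f ` A)) :: 'c)"
    using sum_eq[of "\<lambda>_. 1"] by simp
  moreover have "(of_nat (card A) :: 'c) \<noteq> 0"
    using False \<open>finite A\<close> by simp
  ultimately have "(of_nat c :: 'c) \<noteq> 0" by auto
  then show ?thesis
    by (simp add: mean_def sum_eq card_eq)
qed (simp add: mean_def)

lemma (in group) bij_betw_cmult: "a \<in> carrier G \<Longrightarrow> bij_betw (\<lambda>x. a \<otimes> x) (carrier G) (carrier G)"
  by (simp add: bij_betw_def inj_on_cmult surj_const_mult)

lemma (in group) bij_betw_multc: "a \<in> carrier G \<Longrightarrow> bij_betw (\<lambda>x. x \<otimes> a) (carrier G) (carrier G)"
  by (rule bij_betwI[where g = "\<lambda>x. x \<otimes> inv a"]) (auto simp: m_assoc)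

lemma (in group) mean_image_right_compatible:
  assumes "finite (carrier G)"
    and compat: "\<And>a b c. \<lbrakk>a \<in> carrier G; b \<in> carrier G; c \<in> carrier G; f a = f b\<rbrakk>
      \<Longrightarrow> f (a \<otimes> c) = f (b \<otimes> c)"
  shows "mean F (f ` carrier G) = mean (\<lambda>a. F (f a)) (carrier G)"
proof (rule mean_image_equal_card_fibres[OF \<open>finite (carrier G)\<close>])
  fix y assume "y \<in> f ` carrier G"
  then obtain b where b: "b \<in> carrier G" "y = f b" by blast
  have "f (a \<otimes> b) = f b \<longleftrightarrow> f a = f \<one>" if "a \<in> carrier G" for a
    using compat[of "a \<otimes> b" b "inv b"] compat[of a \<one> b] that b(1) by (auto simp: m_assoc)
  then have "bij_betw (\<lambda>a. a \<otimes> b) {a \<in> carrier G. f a = f \<one>} {a \<in> carrier G. f a = y}"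
    using bij_betw_multc[OF b(1)] b(2) by (intro bij_betw_Collect) auto
  then show "card {a \<in> carrier G. f a = y} = card {a \<in> carrier G. f a = f \<one>}"
    by (simp add: bij_betw_same_card)
qed

lemma (in group) mean_carrier_eq_mean_subgroup:
  assumes finite: "finite (carrier G)" and H: "subgroup H G"
    and translate_by_subgroup: "\<And>a. a \<in> carrier G \<Longrightarrow> \<exists>b\<in>H. \<forall>h\<in>H. F (h \<otimes> a) = F (h \<otimes> b)"
  shows "mean F (carrier G) = mean F H"
proof -
  interpret H: subgroup H G by (rule H)
  have mean_right_translate: "mean (\<lambda>h. F (h \<otimes> a)) H = mean F H" if "a \<in> carrier G" for a
  proof -
    obtain b where b: "b \<in> H" "\<And>h. h \<in> H \<Longrightarrow> F (h \<otimes> a) = F (h \<otimes> b)"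
      using translate_by_subgroup[OF \<open>a \<in> carrier G\<close>] by blast
    have "mean (\<lambda>h. F (h \<otimes> a)) H = mean (\<lambda>h. F (h \<otimes> b)) H"
      using b(2) by (rule mean_cong)
    also have "\<dots> = mean F H"
      using group.bij_betw_multc[OF H.subgroup_is_group[OF group_axioms], of b] b(1)
      by (intro mean_reindex_bij_betw) simp
    finally show ?thesis .
  qed
  have mean_left_translate: "mean (\<lambda>a. F (h \<otimes> a)) (carrier G) = mean F (carrier G)" if "h \<in> H" for h
    using H.mem_carrier[OF that] by (rule mean_reindex_bij_betw[OF bij_betw_cmult])
  have "finite H" "H \<noteq> {}"
    using finite_subset[OF H.subset finite] H.one_closed by blast+
  then have "mean F (carrier G) = mean (\<lambda>_. mean F (carrier G)) H"
    by (simp add: mean_const)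
  also have "\<dots> = mean (\<lambda>h. mean (\<lambda>a. F (h \<otimes> a)) (carrier G)) H"
    by (rule mean_cong) (rule mean_left_translate[symmetric])
  also have "\<dots> = mean (\<lambda>a. mean (\<lambda>h. F (h \<otimes> a)) H) (carrier G)"
    by (rule mean_swap)
  also have "\<dots> = mean (\<lambda>_. mean F H) (carrier G)"
    by (rule mean_cong) (rule mean_right_translate)
  also have "\<dots> = mean F H"
    using finite carrier_not_empty by (rule mean_const)
  finally show ?thesis .
qed

lemma finite_carrier_sym_group: "finite (carrier (sym_group d))"
  by (simp add: sym_group_def finite_permutations)

lemma mean_perm_orbit:
  assumes "subgroup Z (sym_group d)"
  shows "mean F (perm_orbit Z x) = mean (\<lambda>\<sigma>. F (x \<circ> \<sigma>)) Z"
proof -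
  interpret group "(sym_group d)\<lparr>carrier := Z\<rparr>"
    using assms sym_group_is_group by (rule subgroup.subgroup_is_group)
  have "finite Z"
    using subgroup.subset[OF assms] finite_carrier_sym_group by (rule finite_subset)
  then have "mean F ((\<lambda>\<sigma>. x \<circ> \<sigma>) ` Z) = mean (\<lambda>\<sigma>. F (x \<circ> \<sigma>)) Z"
    using mean_image_right_compatible[of "\<lambda>\<sigma>. x \<circ> \<sigma>" F]
    by (simp add: sym_group_mult comp_assoc[symmetric])
  moreover have "perm_orbit Z x = (\<lambda>\<sigma>. x \<circ> \<sigma>) ` Z"
    by (auto simp: perm_orbit_def comp_def)
  ultimately show ?thesis by simp
qed

lemma acts_transitively_on_orbit_eq:
  assumes "acts_transitively_on d H \<phi> E" "a \<in> E"
  shows "orbit ((sym_group d)\<lparr>carrier := H\<rparr>) \<phi> a = E"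
  using assms unfolding acts_transitively_on_def orbits_def by blast

lemma acts_transitively_onE:
  assumes "acts_transitively_on d H \<phi> E" "a \<in> E" "b \<in> E"
  obtains \<rho> where "\<rho> \<in> H" "\<phi> \<rho> a = b"
  using acts_transitively_on_orbit_eq[OF assms(1,2)] assms(3) by (auto simp: orbit_def)

lemma acts_transitively_on_nonempty: "acts_transitively_on d H \<phi> E \<Longrightarrow> E \<noteq> {}"
  by (auto simp: acts_transitively_on_def orbits_def)

lemma multiply_transitive_le:
  assumes "multiply_transitive d k H"
  shows "k \<le> d"
proof -
  obtain xs :: "nat list" where "length xs = k" "distinct xs" "set xs \<subseteq> {1..d}"
    using acts_transitively_on_nonempty assms unfolding multiply_transitive_def by blast
  then show ?thesis
    using card_mono[of "{1..d}" "set xs"] by (simp add: distinct_card)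
qed

lemma obtain_distinct_list_between:
  assumes "finite A" "K \<subseteq> A" "card K \<le> k" "k \<le> card A"
  obtains xs where "distinct xs" "length xs = k" "K \<subseteq> set xs" "set xs \<subseteq> A"
proof -
  obtain L where L: "K \<subseteq> L" "L \<subseteq> A" "card L = k"
    using exists_subset_between[of K k A] assms by blast
  obtain xs where "set xs = L" "distinct xs"
    using finite_distinct_list finite_subset[OF L(2) assms(1)] by blast
  then show thesis using that L distinct_card by metis
qed

lemma multiply_transitive_agree_on:
  assumes trans: "multiply_transitive d k H" and K: "K \<subseteq> {1..d}" "card K \<le> k"
    and \<tau>: "\<tau> permutes {1..d}"
  obtains \<rho> where "\<rho> \<in> H" "\<And>i. i \<in> K \<Longrightarrow> \<rho> i = \<tau> i"
proof -
  let ?E = "{xs. length xs = k \<and> distinct xs \<and> set xs \<subseteq> {1..d}}"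
  obtain xs where xs: "distinct xs" "length xs = k" "K \<subseteq> set xs" "set xs \<subseteq> {1..d}"
    using obtain_distinct_list_between[of "{1..d}" K k] K multiply_transitive_le[OF trans] by auto
  have "acts_transitively_on d H map ?E"
    using trans by (simp add: multiply_transitive_def)
  moreover have "xs \<in> ?E" using xs by simp
  moreover have "map \<tau> xs \<in> ?E"
    using xs permutes_inj_on[OF \<tau>] image_mono[OF xs(4), of \<tau>] permutes_image[OF \<tau>]
    by (simp add: distinct_map)
  ultimately obtain \<rho> where "\<rho> \<in> H" "map \<rho> xs = map \<tau> xs"
    by (rule acts_transitively_onE)
  then show thesis using that xs(3) by auto
qed

lemma homogeneous_same_image:
  assumes hom: "homogeneous d k H" and K: "K \<subseteq> {1..d}" "card K = k"
    and \<tau>: "\<tau> permutes {1..d}"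
  obtains \<rho> where "\<rho> \<in> H" "\<rho> ` K = \<tau> ` K"
proof -
  have "\<tau> ` K \<subseteq> {1..d}" "card (\<tau> ` K) = k"
    using K permutes_image[OF \<tau>] permutes_inj_on[OF \<tau>] by (auto simp: card_image)
  then show thesis
    using K that acts_transitively_onE[OF hom[unfolded homogeneous_def], of K "\<tau> ` K"] by blast
qed

definition monomial_eval :: "('i \<Rightarrow>\<^sub>0 nat) \<Rightarrow> ('i \<Rightarrow> 'a::comm_monoid_mult) \<Rightarrow> 'a" where
  "monomial_eval m y = (\<Prod>i\<in>Poly_Mapping.keys m. y i ^ Poly_Mapping.lookup m i)"

lemma mpoly_eval_eq_sum_monomial_eval:
  "mpoly_eval f y = (\<Sum>m\<in>Poly_Mapping.keys f. Poly_Mapping.lookup f m * monomial_eval m y)"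
  by (simp add: mpoly_eval_def monomial_eval_def)

lemma monomial_eval_comp_cong:
  assumes "\<And>i. i \<in> Poly_Mapping.keys m \<Longrightarrow> \<rho> i = \<tau> i"
  shows "monomial_eval m (y \<circ> \<rho>) = monomial_eval m (y \<circ> \<tau>)"
  using assms by (simp add: monomial_eval_def)

lemma monomial_eval_comp_multilinear:
  assumes "\<And>i. i \<in> Poly_Mapping.keys m \<Longrightarrow> Poly_Mapping.lookup m i = 1"
    and "inj_on \<rho> (Poly_Mapping.keys m)"
  shows "monomial_eval m (y \<circ> \<rho>) = prod y (\<rho> ` Poly_Mapping.keys m)"
  using assms by (simp add: monomial_eval_def prod.reindex)

lemma card_keys_le_monomial_degree: "card (Poly_Mapping.keys m) \<le> monomial_degree m"
  unfolding monomial_degree_def card_eq_sum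
  by (rule sum_mono) (simp add: in_keys_iff)

lemma lookup_eq_1_if_monomial_degree_le_card_keys:
  assumes "monomial_degree m \<le> card (Poly_Mapping.keys m)" "i \<in> Poly_Mapping.keys m"
  shows "Poly_Mapping.lookup m i = 1"
proof (rule ccontr)
  assume "Poly_Mapping.lookup m i \<noteq> 1"
  then have "card (Poly_Mapping.keys m) < monomial_degree m"
    unfolding monomial_degree_def card_eq_sum
    using assms(2) by (intro sum_strict_mono_ex1) (auto simp: in_keys_iff intro!: bexI[of _ i])
  then show False using assms(1) by simp
qed

lemma monomial_eval_comp_eq_transitive_subgroup:
  assumes Z: "subgroup Z (sym_group d)"
    and trans: "multiply_transitive d (t - 1) Z" and hom: "homogeneous d t Z"
    and keys: "Poly_Mapping.keys m \<subseteq> {1..d}" and degree: "monomial_degree m \<le> t"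
    and \<tau>: "\<tau> permutes {1..d}"
  obtains \<rho> where "\<rho> \<in> Z" "\<And>y. monomial_eval m (y \<circ> \<tau>) = monomial_eval m (y \<circ> \<rho>)"
proof (cases "card (Poly_Mapping.keys m) \<le> t - 1")
  case True
  then obtain \<rho> where "\<rho> \<in> Z" "\<And>i. i \<in> Poly_Mapping.keys m \<Longrightarrow> \<rho> i = \<tau> i"
    using multiply_transitive_agree_on[OF trans keys _ \<tau>] by blast
  then show thesis using that monomial_eval_comp_cong by metis
next
  case False
  then have card: "card (Poly_Mapping.keys m) = t"
    using card_keys_le_monomial_degree[of m] degree by simp
  then obtain \<rho> where \<rho>: "\<rho> \<in> Z" "\<rho> ` Poly_Mapping.keys m = \<tau> ` Poly_Mapping.keys m"
    using homogeneous_same_image[OF hom keys _ \<tau>] by blast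
  have "Poly_Mapping.lookup m i = 1" if "i \<in> Poly_Mapping.keys m" for i
    using lookup_eq_1_if_monomial_degree_le_card_keys[OF _ that] degree card by simp
  moreover have "\<rho> permutes {1..d}"
    using subgroup.mem_carrier[OF Z \<rho>(1)] by (simp add: sym_group_carrier)
  ultimately show thesis
    using that[OF \<rho>(1)] \<rho>(2) \<tau> by (simp add: monomial_eval_comp_multilinear permutes_inj_on)
qed

lemma mean_monomial_eval_eq_transitive_subgroup:
  fixes x :: "nat \<Rightarrow> 'a::field_char_0"
  assumes Z: "subgroup Z (sym_group d)"
    and "multiply_transitive d (t - 1) Z" "homogeneous d t Z"
    and "Poly_Mapping.keys m \<subseteq> {1..d}" "monomial_degree m \<le> t"
  shows "mean (\<lambda>\<sigma>. monomial_eval m (x \<circ> \<sigma>)) (carrier (sym_group d))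
       = mean (\<lambda>\<sigma>. monomial_eval m (x \<circ> \<sigma>)) Z"
proof (rule group.mean_carrier_eq_mean_subgroup[OF sym_group_is_group finite_carrier_sym_group Z])
  fix \<tau> assume "\<tau> \<in> carrier (sym_group d)"
  then obtain \<rho> where "\<rho> \<in> Z"
    and "\<And>y :: nat \<Rightarrow> 'a. monomial_eval m (y \<circ> \<tau>) = monomial_eval m (y \<circ> \<rho>)"
    using monomial_eval_comp_eq_transitive_subgroup[OF assms] unfolding sym_group_carrier by blast
  then show "\<exists>\<rho>\<in>Z. \<forall>\<sigma>\<in>Z. monomial_eval m (x \<circ> (\<sigma> \<otimes>\<^bsub>sym_group d\<^esub> \<tau>))
      = monomial_eval m (x \<circ> (\<sigma> \<otimes>\<^bsub>sym_group d\<^esub> \<rho>))"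
    by (intro bexI[of _ \<rho>]) (simp_all add: sym_group_mult comp_assoc[symmetric])
qed

theorem theorem3p3:
  fixes d t :: nat
    and Z :: "(nat \<Rightarrow> nat) set"
    and x :: "nat \<Rightarrow> real"
    and f :: real_mpoly
  assumes "d \<ge> 1" and "t \<ge> 1"
    and "subgroup Z (sym_group d)"
    and "multiply_transitive d (t - 1) Z"
    and "homogeneous d t Z"
    and "x \<in> {1..d} \<rightarrow>\<^sub>E UNIV"
    and "f \<in> mpolys_le d t"
  shows "1 / real (card (perm_orbit (carrier (sym_group d)) x)) *
           (\<Sum>y\<in>perm_orbit (carrier (sym_group d)) x. mpoly_eval f y)
       = 1 / real (card (perm_orbit Z x)) * (\<Sum>y\<in>perm_orbit Z x. mpoly_eval f y)"
proof -
  let ?S = "carrier (sym_group d)"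
  have mean_orbit: "mean (mpoly_eval f) (perm_orbit H x)
      = (\<Sum>m\<in>Poly_Mapping.keys f. Poly_Mapping.lookup f m *
           mean (\<lambda>\<sigma>. monomial_eval m (x \<circ> \<sigma>)) H)" if "subgroup H (sym_group d)" for H
    by (simp add: mean_perm_orbit[OF that] mpoly_eval_eq_sum_monomial_eval mean_linear_combination)
  have "subgroup ?S (sym_group d)"
    by (rule group.subgroup_self[OF sym_group_is_group])
  moreover have "mean (\<lambda>\<sigma>. monomial_eval m (x \<circ> \<sigma>)) ?S = mean (\<lambda>\<sigma>. monomial_eval m (x \<circ> \<sigma>)) Z"
    if "m \<in> Poly_Mapping.keys f" for m
    using mean_monomial_eval_eq_transitive_subgroup[OF assms(3-5)] that assms(7)
    unfolding mpolys_le_def by blast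
  ultimately have "mean (mpoly_eval f) (perm_orbit ?S x) = mean (mpoly_eval f) (perm_orbit Z x)"
    using assms(3) by (simp add: mean_orbit)
  then show ?thesis
    by (simp add: mean_def)
qed

end
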